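(* Let $n\geq 1$ and let $g$ be a Riemannian metric on the manifold $\mathrm{Sym}^+(n)$ of $n\times n$ real symmetric positive definite matrices. The following statements are equivalent (all invariances being with respect to the congruence action): 1. $g$ is $\mathrm{GL}(n)$-invariant; 2. $g$ is $\mathrm{GL}^+(n)$-invariant; 3. $g$ is $\mathrm{SL}(n)$-invariant and $\mathbb{R}^+$-invariant; 4. $g$ is $\mathrm{SO}(n)$-invariant and $\mathrm{Diag}^+(n)$-invariant; 5. $g$ is $\mathfrak{S}(n)$-invariant and $\mathrm{LT}^+(n)$-invariant.
   Context: The congruence action of the real general linear group $\mathrm{GL}(n)$ on $\mathrm{Sym}^+(n)$ is $(A,\Sigma)\mapsto A\Sigma A^\top$. For a subgroup $G\subseteq\mathrm{GL}(n)$, a Riemannian metric $g$ on $\mathrm{Sym}^+(n)$ is $G$-invariant if $g_{A\Sigma A^\top}(AVA^\top,AWA^\top)=g_\Sigma(V,W)$ for all $A\in G$, $\Sigma\in\mathrm{Sym}^+(n)$ and all symmetric matrices $V,W$ (tangent vectors at $\Sigma$). Subgroups: $\mathrm{GL}^+(n)$ is the group of real matrices with positive determinant; $\mathrm{SL}(n)$ those of determinant $1$; $\mathrm{SO}(n)$ the special orthogonal group; $\mathrm{LT}^+(n)$ the group of lower triangular matrices with positive diagonal entries; $\mathrm{Diag}^+(n)$ the group of diagonal matrices with positive diagonal entries; $\mathbb{R}^+$ is the group of positive real numbers viewed in $\mathrm{GL}(n)$ via $\lambda\mapsto\lambda I_n$; $\mathfrak{S}(n)$ is the symmetric group on $\{1,\dots,n\}$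 viewed in $\mathrm{GL}(n)$ via permutation matrices $[P_\sigma]_{ij}=\delta_{i,\sigma(j)}$. *)

theory Defs
  imports "HOL-Analysis.Analysis" "HOL-Combinatorics.Permutations"
begin

text \<open>
  The index type \<open>'n\<close> plays the role of \<open>{1, ..., n}\<close>, with \<open>n = CARD('n) \<ge> 1\<close>.  A linear order
  on \<open>'n\<close> is needed only to speak of lower triangular matrices; every finite linear order is
  isomorphic to some \<open>{1, ..., n}\<close>.
\<close>

definition Sym :: "(real^'n^'n) set" where
  "Sym = {V. transpose V = V}"

definition SymPos :: "(real^'n^'n) set" where
  "SymPos = {\<Sigma> \<in> Sym. \<forall>x. x \<noteq> 0 \<longrightarrow> x \<bullet> (\<Sigma> *v x) > 0}"

text \<open>
  \<^const>\<open>SymPos\<close> is an open subset of the vector space \<^const>\<open>Sym\<close>, which is its tangent space at every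
  point.  Since it is not open in the space of all matrices, derivatives are taken within
  \<^const>\<open>SymPos\<close>; such a derivative is determined exactly on \<^const>\<open>Sym\<close>, and only its values there
  are used.  For \<open>f\<close> real-valued, \<open>C_k k f\<close> says that \<open>f\<close> is of class \<open>C\<^sup>k\<close> on \<^const>\<open>SymPos\<close>.
\<close>

fun C_k :: "nat \<Rightarrow> (real^'n^'n \<Rightarrow> real) \<Rightarrow> bool" where
  "C_k 0 f \<longleftrightarrow> continuous_on SymPos f"
| "C_k (Suc k) f \<longleftrightarrow>
    (\<exists>f'. (\<forall>\<Sigma>\<in>SymPos. (f has_derivative f' \<Sigma>) (at \<Sigma> within SymPos)) \<and>
          (\<forall>V\<in>Sym. C_k k (\<lambda>\<Sigma>. f' \<Sigma> V)))"

definition smooth_on_SymPos :: "(real^'n^'n \<Rightarrow> real) \<Rightarrow> bool" where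
  "smooth_on_SymPos f \<longleftrightarrow> (\<forall>k. C_k k f)"

definition inner_product_on_Sym :: "(real^'n^'n \<Rightarrow> real^'n^'n \<Rightarrow> real) \<Rightarrow> bool" where
  "inner_product_on_Sym b \<longleftrightarrow>
     (\<forall>U\<in>Sym. \<forall>V\<in>Sym. \<forall>W\<in>Sym. b (U + V) W = b U W + b V W) \<and>
     (\<forall>c. \<forall>V\<in>Sym. \<forall>W\<in>Sym. b (c *\<^sub>R V) W = c * b V W) \<and>
     (\<forall>V\<in>Sym. \<forall>W\<in>Sym. b V W = b W V) \<and>
     (\<forall>V\<in>Sym. V \<noteq> 0 \<longrightarrow> b V V > 0)"

text \<open>
  Metrics are total functions, but only the values \<open>g \<Sigma> V W\<close> with \<open>\<Sigma>\<close> in \<^const>\<open>SymPos\<close> and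
  \<open>V\<close>, \<open>W\<close> in \<^const>\<open>Sym\<close> are constrained.  Since the tangent bundle is trivial, \<open>g\<close> is a smooth tensor
  field iff all its components with respect to constant vector fields are smooth.
\<close>

definition riemannian_metric ::
    "(real^'n^'n \<Rightarrow> real^'n^'n \<Rightarrow> real^'n^'n \<Rightarrow> real) \<Rightarrow> bool" where
  "riemannian_metric g \<longleftrightarrow>
     (\<forall>\<Sigma>\<in>SymPos. inner_product_on_Sym (g \<Sigma>)) \<and>
     (\<forall>V\<in>Sym. \<forall>W\<in>Sym. smooth_on_SymPos (\<lambda>\<Sigma>. g \<Sigma> V W))"

definition congr :: "real^'n^'n \<Rightarrow> real^'n^'n \<Rightarrow> real^'n^'n" where
  "congr A X = A ** X ** transpose A"

definition invariant ::
    "(real^'n^'n) set \<Rightarrow> (real^'n^'n \<Rightarrow> real^'n^'n \<Rightarrow> real^'n^'n \<Rightarrow> real) \<Rightarrow> bool" where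
  "invariant G g \<longleftrightarrow>
     (\<forall>A\<in>G. \<forall>\<Sigma>\<in>SymPos. \<forall>V\<in>Sym. \<forall>W\<in>Sym.
        g (congr A \<Sigma>) (congr A V) (congr A W) = g \<Sigma> V W)"

definition GL :: "(real^'n^'n) set" where
  "GL = {A. invertible A}"

definition GL_pos :: "(real^'n^'n) set" where
  "GL_pos = {A. det A > 0}"

definition SL :: "(real^'n^'n) set" where
  "SL = {A. det A = 1}"

definition SO :: "(real^'n^'n) set" where
  "SO = {A. orthogonal_matrix A \<and> det A = 1}"

definition LT_pos :: "(real^'n::{finite,linorder}^'n::{finite,linorder}) set" where
  "LT_pos = {A. (\<forall>i j. i < j \<longrightarrow> A $ i $ j = 0) \<and> (\<forall>i. A $ i $ i > 0)}"

definition Diag_pos :: "(real^'n^'n) set" where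
  "Diag_pos = {A. (\<forall>i j. i \<noteq> j \<longrightarrow> A $ i $ j = 0) \<and> (\<forall>i. A $ i $ i > 0)}"

definition pos_scalars :: "(real^'n^'n) set" where
  "pos_scalars = {c *\<^sub>R mat 1 | c. c > 0}"

definition perm_matrix :: "('n \<Rightarrow> 'n) \<Rightarrow> real^'n^'n" where
  "perm_matrix \<sigma> = (\<chi> i j. if i = \<sigma> j then 1 else 0)"

definition perm_matrices :: "(real^'n^'n) set" where
  "perm_matrices = {perm_matrix \<sigma> | \<sigma>. \<sigma> permutes UNIV}"

end

theory Submission
  imports Defs
begin

text \<open>
  \<open>GL\<^sup>+(n)\<close>-invariance gives \<open>GL(n)\<close>-invariance even for even \<open>n\<close>, although \<open>-I\<close> then has
  determinant 1: by polarization it suffices to compare the values on \<open>(V, V)\<close>, and for every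
  \<open>\<Sigma>\<close> and \<open>V\<close> there is a matrix \<open>B\<close> of negative determinant whose congruence action fixes both, so
  that \<open>A\<close> may be replaced by \<open>A B\<close>.  The pair \<open>SL(n), \<real>\<^sup>+\<close> generates \<open>GL\<^sup>+(n)\<close> by scaling,
  and so does \<open>SO(n), Diag\<^sup>+(n)\<close> by the polar decomposition.  Finally \<open>\<SS>(n)\<close> and \<open>LT\<^sup>+(n)\<close>
  generate all elementary matrices, since transposing two coordinates turns upper shears into lower
  ones, and sign changes of one coordinate are products of shears and a transposition; only for
  \<open>n = 1\<close> is the sign change \<open>-I\<close> not generated, but it acts trivially.
\<close>

subsection \<open>Spectral theorem\<close>

lemma Sym_inner:
  fixes V :: "real^'n^'n"
  assumes "V \<in> Sym"
  shows "x \<bullet> (V *v y) = (V *v x) \<bullet> y"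
  using assms by (metis (mono_tags, lifting) Sym_def dot_lmul_matrix mem_Collect_eq vector_transpose_matrix)

text \<open>First-order condition at a minimum: were \<open>b\<close> nonzero, the linear term would
  win for small \<open>t\<close> of sign opposite to \<open>b\<close>. It is applied below to a
  variation around a maximizer.\<close>

lemma nonneg_quadratic_imp_linear_zero:
  fixes b c :: real
  assumes "\<And>t. 0 \<le> 2 * t * b + t\<^sup>2 * c"
  shows "b = 0"
proof (rule ccontr)
  assume "b \<noteq> 0"
  \<comment> \<open>Chosen positive and larger than \<open>c\<close>, so that
    \<open>t = - b / k\<close> is small enough for the quadratic to be negative.\<close>
  define k where "k = \<bar>c\<bar> + 1"
  have "k > 0" "c < k" by (auto simp: k_def)
  have "0 \<le> 2 * (- b / k) * b + (- b / k)\<^sup>2 * c" by (rule assms)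
  also have "\<dots> = (b\<^sup>2 / k\<^sup>2) * (c - 2 * k)"
    using \<open>k > 0\<close> by (simp add: field_simps power2_eq_square)
  also have "\<dots> < 0"
    using \<open>k > 0\<close> \<open>c < k\<close> \<open>b \<noteq> 0\<close> by (intro mult_pos_neg) auto
  finally show False by simp
qed

text \<open>A maximizer of the Rayleigh quotient on the unit sphere of \<open>S\<close> is an
  eigenvector. Working in an invariant subspace allows eigenvectors to be split off one at a
  time.\<close>

lemma Sym_eigenvector_in_subspace:
  fixes V :: "real^'n^'n"
  assumes V: "V \<in> Sym" and S: "subspace S" and inv: "\<And>x. x \<in> S \<Longrightarrow> V *v x \<in> S"
    and z: "z \<in> S" "z \<noteq> 0"
  obtains v k where "v \<in> S" "norm v = 1" "V *v v = k *\<^sub>R v"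
proof -
  define K where "K = S \<inter> sphere 0 1"
  have "compact K"
    unfolding K_def using closed_subspace[OF S] by (simp add: closed_Int_compact)
  moreover have "K \<noteq> {}"
  proof -
    have "(1 / norm z) *\<^sub>R z \<in> K"
      using z S by (auto simp: K_def subspace_mul)
    then show ?thesis by blast
  qed
  moreover have "continuous_on K (\<lambda>x. x \<bullet> (V *v x))"
    by (intro continuous_intros)
  ultimately obtain v where v: "v \<in> K" and vmax: "\<And>x. x \<in> K \<Longrightarrow> x \<bullet> (V *v x) \<le> v \<bullet> (V *v v)"
    using continuous_attains_sup[of K "\<lambda>x. x \<bullet> (V *v x)"] by auto
  define k where "k = v \<bullet> (V *v v)"
  have vS: "v \<in> S" and nv: "norm v = 1" using v by (auto simp: K_def)
  then have vv: "v \<bullet> v = 1" by (simp add: norm_eq_1)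
  \<comment> \<open>By homogeneity, maximality of \<open>v\<close> on the sphere means that
    \<open>q\<close> is nonnegative on all of \<open>S\<close>, with value 0 at
    \<open>v\<close>.\<close>
  define q where "q = (\<lambda>x. k * (x \<bullet> x) - x \<bullet> (V *v x))"
  have q_nonneg: "q x \<ge> 0" if "x \<in> S" for x
  proof (cases "x = 0")
    case True
    then show ?thesis by (simp add: q_def)
  next
    case False
    let ?y = "(1 / norm x) *\<^sub>R x"
    have "?y \<in> S" using S that by (rule subspace_mul)
    then have "?y \<in> K" using False by (simp add: K_def)
    then have "?y \<bullet> (V *v ?y) \<le> k" using vmax k_def by blast
    moreover have "?y \<bullet> (V *v ?y) = (x \<bullet> (V *v x)) / (norm x)\<^sup>2"
      by (simp only: matrix_vector_mult_scaleR inner_scaleR_left inner_scaleR_right)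
         (simp add: power2_eq_square)
    ultimately have "(x \<bullet> (V *v x)) / (norm x)\<^sup>2 \<le> k"
      by simp
    then have "x \<bullet> (V *v x) \<le> k * (norm x)\<^sup>2"
      using False by (simp add: divide_le_eq)
    then show ?thesis by (simp add: q_def power2_norm_eq_inner)
  qed
  \<comment> \<open>The residual of the eigenvector equation. It lies in \<open>S\<close> by
    invariance, and the linear coefficient of \<open>q (v + t *\<^sub>R w)\<close> in
    \<open>t\<close> is twice its squared norm.\<close>
  define w where "w = k *\<^sub>R v - V *v v"
  have "w \<in> S" unfolding w_def using S vS inv by (intro subspace_diff subspace_mul) auto
  have "q v = 0" by (simp add: q_def k_def vv)
  have "0 \<le> 2 * t * (w \<bullet> w) + t\<^sup>2 * q w" for t
  proof -
    have sym: "v \<bullet> (V *v w) = w \<bullet> (V *v v)"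
      by (metis Sym_inner V inner_commute)
    have "q (v + t *\<^sub>R w) = q v + 2 * t * (w \<bullet> (k *\<^sub>R v - V *v v)) + t\<^sup>2 * q w"
      using sym
      by (simp add: q_def matrix_vector_right_distrib matrix_vector_mult_scaleR inner_simps
          inner_commute[of v w] algebra_simps power2_eq_square)
    moreover have "0 \<le> q (v + t *\<^sub>R w)"
      using S vS \<open>w \<in> S\<close> by (intro q_nonneg subspace_add subspace_mul)
    ultimately show ?thesis using \<open>q v = 0\<close> by (simp add: w_def)
  qed
  then have "w \<bullet> w = 0" by (rule nonneg_quadratic_imp_linear_zero)
  then have "V *v v = k *\<^sub>R v" by (simp add: w_def)
  then show thesis using that vS nv by blast
qed

text \<open>Induction on \<open>m\<close>: the orthogonal complement of the eigenvectors found so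
  far is invariant because \<open>V\<close> is symmetric, and it is nonzero since fewer than
  \<open>CARD('n)\<close> vectors cannot span.\<close>

lemma Sym_orthonormal_eigenvectors:
  fixes V :: "real^'n^'n"
  assumes V: "V \<in> Sym" and "m \<le> CARD('n)"
  shows "\<exists>B. finite B \<and> card B = m \<and> pairwise orthogonal B \<and>
           (\<forall>b\<in>B. norm b = 1 \<and> (\<exists>k. V *v b = k *\<^sub>R b))"
  using assms(2)
proof (induction m)
  case 0
  then show ?case by (intro exI[of _ "{}"]) auto
next
  case (Suc m)
  then obtain B where B: "finite B" "card B = m" "pairwise orthogonal B"
    "\<And>b. b \<in> B \<Longrightarrow> norm b = 1" "\<And>b. b \<in> B \<Longrightarrow> \<exists>k. V *v b = k *\<^sub>R b"
    by (metis Suc_leD)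
  define S where "S = {x. \<forall>b\<in>B. b \<bullet> x = 0}"
  have "subspace S"
    by (auto simp: S_def subspace_def inner_simps)
  moreover have "V *v x \<in> S" if "x \<in> S" for x
  proof -
    have "b \<bullet> (V *v x) = 0" if "b \<in> B" for b
      using B(5)[OF that] \<open>x \<in> S\<close> that by (auto simp: Sym_inner[OF V] S_def)
    then show ?thesis by (simp add: S_def)
  qed
  moreover obtain z where "z \<in> S" "z \<noteq> 0"
  proof -
    have "dim B < DIM(real^'n)"
      using dim_le_card'[OF B(1)] B(2) Suc.prems by simp
    then obtain z where "z \<noteq> 0" "\<And>y. y \<in> span B \<Longrightarrow> orthogonal z y"
      using orthogonal_to_subspace_exists by blast
    moreover from this have "z \<in> S"
      unfolding S_def orthogonal_def by (simp add: span_base inner_commute[of _ z])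
    ultimately show thesis using that by blast
  qed
  ultimately obtain v k where v: "v \<in> S" "norm v = 1" "V *v v = k *\<^sub>R v"
    using Sym_eigenvector_in_subspace[OF V] by metis
  have "v \<notin> B"
    using v(1,2) by (auto simp: S_def norm_eq_1)
  moreover have "pairwise orthogonal (insert v B)"
    using B(3) v(1) by (auto simp: pairwise_insert S_def orthogonal_def inner_commute)
  ultimately show ?case
    using B v by (intro exI[of _ "insert v B"]) auto
qed

section \<open>Diagonal matrices, coordinate reflections and orthogonal diagonalization\<close>

definition diag_mat :: "('n \<Rightarrow> real) \<Rightarrow> real^'n^'n" where
  "diag_mat d = (\<chi> i j. if i = j then d i else 0)"

lemma diag_mat_mult: "diag_mat d ** diag_mat e = diag_mat (\<lambda>i. d i * e i)"
  by (simp add: diag_mat_def matrix_matrix_mult_def vec_eq_iff mult_delta_left mult_delta_right)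

lemma transpose_diag_mat [simp]: "transpose (diag_mat d) = diag_mat d"
  by (auto simp: diag_mat_def transpose_def vec_eq_iff)

lemma diag_mat_1: "diag_mat (\<lambda>i. 1) = mat 1"
  by (simp add: diag_mat_def mat_def)

lemma diag_mat_const: "diag_mat (\<lambda>i. c) = c *\<^sub>R mat 1"
  by (simp add: diag_mat_def mat_def vec_eq_iff)

lemma diag_mat_vec: "(diag_mat d *v x) $ i = d i * x $ i"
  by (simp add: diag_mat_def matrix_vector_mult_def mult_delta_left)

lemma diag_mat_axis: "diag_mat d *v axis i 1 = d i *\<^sub>R axis i 1"
  by (auto simp: diag_mat_vec vec_eq_iff axis_def)

lemma det_diag_mat: "det (diag_mat d) = prod d UNIV"
  by (subst det_diagonal) (auto simp: diag_mat_def)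

text \<open>The reflection in the \<open>k\<close>-th coordinate hyperplane. It has determinant -1
  and fixes diagonal matrices under conjugation, so it serves to correct the sign of a
  determinant.\<close>

abbreviation flip_mat :: "'n \<Rightarrow> real^'n^'n" where
  "flip_mat k \<equiv> diag_mat (\<lambda>i. if i = k then -1 else 1)"

lemma flip_mat_square: "flip_mat k ** flip_mat k = mat 1"
proof -
  have "(\<lambda>i. (if i = k then -1 else 1 :: real) * (if i = k then -1 else 1)) = (\<lambda>i. 1)"
    by auto
  then show ?thesis by (simp only: diag_mat_mult diag_mat_1)
qed

lemma det_flip_mat: "det (flip_mat k) = -1"
  by (simp add: det_diag_mat)

lemma flip_mat_conj_diag_mat: "flip_mat k ** diag_mat d ** flip_mat k = diag_mat d"
proof -
  have "(\<lambda>i. (if i = k then -1 else 1) * d i * (if i = k then -1 else 1)) = d"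
    by auto
  then show ?thesis by (simp only: diag_mat_mult)
qed

text \<open>The columns of \<open>Q\<close> are an orthonormal eigenbasis, so
  \<open>V ** Q = Q ** diag_mat d\<close>.\<close>

lemma Sym_diagonalize_orthogonal:
  fixes V :: "real^'n^'n"
  assumes V: "V \<in> Sym"
  shows "\<exists>Q d. orthogonal_matrix Q \<and> V = Q ** diag_mat d ** transpose Q"
proof -
  obtain B where B: "finite B" "card B = CARD('n)" "pairwise orthogonal B"
    "\<And>b. b \<in> B \<Longrightarrow> norm b = 1" "\<And>b. b \<in> B \<Longrightarrow> \<exists>k. V *v b = k *\<^sub>R b"
    using Sym_orthonormal_eigenvectors[OF V order_refl] by metis
  obtain f where f: "bij_betw f (UNIV :: 'n set) B"
    using finite_same_card_bij[OF finite_class.finite_UNIV B(1)] B(2) by metis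
  then have fB: "f i \<in> B" for i by (auto simp: bij_betw_def)
  obtain d where d: "V *v f i = d i *\<^sub>R f i" for i
    using B(5)[OF fB] by metis
  define Q :: "real^'n^'n" where "Q = (\<chi> i j. f j $ i)"
  have col: "column j Q = f j" for j
    by (simp add: Q_def column_def)
  have "orthogonal (f i) (f j)" if "i \<noteq> j" for i j
    using that B(3) fB f by (metis UNIV_I bij_betw_def inj_onD pairwiseD)
  then have Q: "orthogonal_matrix Q"
    using B(4) fB by (simp add: orthogonal_matrix_orthonormal_columns col)
  have QQ: "Q ** transpose Q = mat 1" using Q by (simp add: orthogonal_matrix_def)
  have "V ** Q = Q ** diag_mat d"
  proof -
    have "(V ** Q) $ i $ j = (V *v f j) $ i" for i j
      by (simp add: matrix_matrix_mult_def matrix_vector_mult_def Q_def)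
    moreover have "(Q ** diag_mat d) $ i $ j = (d j *\<^sub>R f j) $ i" for i j
      by (simp add: matrix_matrix_mult_def diag_mat_def Q_def mult_delta_left mult_delta_right)
    ultimately show ?thesis by (simp add: vec_eq_iff d)
  qed
  then have "V = Q ** diag_mat d ** transpose Q"
    by (metis QQ matrix_mul_assoc matrix_mul_rid)
  with Q show ?thesis by blast
qed

text \<open>Flipping the sign of one column of \<open>Q\<close> leaves \<open>Q D Q\<^sup>T\<close> unchanged, so \<open>det Q = 1\<close>
  can be arranged.\<close>

proposition Sym_diagonalize:
  fixes V :: "real^'n^'n"
  assumes "V \<in> Sym"
  obtains Q d where "Q \<in> SO" "V = Q ** diag_mat d ** transpose Q"
proof -
  obtain Q d where Q: "orthogonal_matrix Q" and V: "V = Q ** diag_mat d ** transpose Q"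
    using Sym_diagonalize_orthogonal[OF assms] by blast
  show thesis
  proof (cases "det Q = 1")
    case True
    then show thesis using that Q V by (auto simp: SO_def)
  next
    case False
    then have "det Q = -1" using det_orthogonal_matrix[OF Q] by blast
    fix k :: 'n
    define R where "R = flip_mat k"
    have R: "orthogonal_matrix R"
      by (simp add: R_def orthogonal_matrix_def flip_mat_square)
    have "Q ** R \<in> SO"
      using Q R \<open>det Q = -1\<close>
      by (simp add: SO_def orthogonal_matrix_mul det_mul det_flip_mat R_def)
    moreover have "V = (Q ** R) ** diag_mat d ** transpose (Q ** R)"
    proof -
      have "(Q ** R) ** diag_mat d ** transpose (Q ** R) = Q ** (R ** diag_mat d ** R) ** transpose Q"
        by (simp add: matrix_transpose_mul matrix_mul_assoc R_def)
      then show ?thesis by (simp add: V R_def flip_mat_conj_diag_mat)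
    qed
    ultimately show thesis using that by blast
  qed
qed

text \<open>Each \<open>d i\<close> is the eigenvalue of the \<open>i\<close>-th column of
  \<open>Q\<close>, so testing positive definiteness on that column gives its sign.\<close>

lemma SymPos_diagonalize:
  fixes \<Sigma> :: "real^'n^'n"
  assumes "\<Sigma> \<in> SymPos"
  obtains Q d where "Q \<in> SO" "\<And>i. d i > 0" "\<Sigma> = Q ** diag_mat d ** transpose Q"
proof -
  have "\<Sigma> \<in> Sym" using assms by (simp add: SymPos_def)
  then obtain Q d where Q: "Q \<in> SO" and \<Sigma>: "\<Sigma> = Q ** diag_mat d ** transpose Q"
    by (rule Sym_diagonalize)
  have QQ: "transpose Q ** Q = mat 1"
    using Q by (simp add: SO_def orthogonal_matrix_def)
  have "d i > 0" for i
  proof -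
    let ?x = "Q *v axis i 1"
    have e: "transpose Q *v ?x = axis i 1"
      by (simp add: matrix_vector_mul_assoc QQ)
    then have "?x \<noteq> 0"
      by (metis axis_eq_0_iff matrix_vector_mult_0_right zero_neq_one)
    then have pos: "0 < ?x \<bullet> (\<Sigma> *v ?x)"
      using assms by (simp add: SymPos_def)
    have "\<Sigma> *v ?x = Q *v (diag_mat d *v (transpose Q *v ?x))"
      by (simp only: \<Sigma> matrix_vector_mul_assoc matrix_mul_assoc)
    then have "\<Sigma> *v ?x = d i *\<^sub>R ?x"
      by (simp only: e diag_mat_axis matrix_vector_mult_scaleR)
    with pos have "0 < d i * (?x \<bullet> ?x)"
      by (simp only: inner_scaleR_right)
    then show "d i > 0"
      using inner_ge_zero[of ?x] unfolding zero_less_mult_iff by linarith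
  qed
  then show thesis by (rule that[OF Q _ \<Sigma>])
qed

subsection \<open>Reduction from the general linear group to positive determinant\<close>

lemma congr_mult: "congr (A ** B) X = congr A (congr B X)"
  by (simp add: congr_def matrix_transpose_mul matrix_mul_assoc)

lemma congr_add: "congr A (X + Y) = congr A X + congr A Y"
  by (simp add: congr_def matrix_add_ldistrib)
    (simp add: matrix_matrix_mult_def vec_eq_iff distrib_right sum.distrib)

text \<open>With \<open>c = -1\<close> this shows that -I acts trivially, which settles dimension
  one later.\<close>

lemma congr_scalar:
  fixes X :: "real^'n^'n"
  shows "congr (c *\<^sub>R mat 1) X = (c * c) *\<^sub>R X"
proof -
  have "transpose (c *\<^sub>R mat 1) = (c *\<^sub>R mat 1 :: real^'n^'n)"
    by (simp only: diag_mat_const[symmetric] transpose_diag_mat)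
  then show ?thesis
    by (simp only: congr_def scalar_matrix_assoc[symmetric] matrix_scalar_ac
        matrix_mul_lid matrix_mul_rid scaleR_scaleR)
qed

lemma congr_Sym: "V \<in> Sym \<Longrightarrow> congr A V \<in> Sym"
  by (simp add: Sym_def congr_def matrix_transpose_mul matrix_mul_assoc)

text \<open>The quadratic form of \<open>congr A \<Sigma>\<close> at \<open>x\<close> is that of
  \<Sigma> at \<open>transpose A *v x\<close>, and the transpose of \<open>A\<close> is
  injective.\<close>

lemma congr_SymPos:
  assumes "invertible A" "\<Sigma> \<in> SymPos"
  shows "congr A \<Sigma> \<in> SymPos"
proof -
  have "x \<bullet> (congr A \<Sigma> *v x) > 0" if "x \<noteq> 0" for x
  proof -
    have "transpose A *v x \<noteq> 0"
      using assms(1) \<open>x \<noteq> 0\<close>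
      by (metis invertible_left_inverse matrix_left_invertible_ker transpose_invertible)
    then have "0 < (transpose A *v x) \<bullet> (\<Sigma> *v (transpose A *v x))"
      using assms(2) by (simp add: SymPos_def)
    moreover have "x \<bullet> (congr A \<Sigma> *v x) = x \<bullet> (A *v (\<Sigma> *v (transpose A *v x)))"
      by (simp only: congr_def matrix_vector_mul_assoc matrix_mul_assoc)
    ultimately show ?thesis
      by (metis dot_lmul_matrix vector_transpose_matrix transpose_transpose)
  qed
  then show ?thesis
    using assms(2) by (auto simp: SymPos_def congr_Sym)
qed

lemma mat_1_SymPos: "mat 1 \<in> SymPos"
  by (simp add: SymPos_def Sym_def)

lemma invariant_subset: "invariant G g \<Longrightarrow> H \<subseteq> G \<Longrightarrow> invariant H g"
  unfolding invariant_def by blast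

text \<open>Invertibility is included so that the action preserves \<open>SymPos\<close>, which
  makes the set closed under products. Invariance under generators thus passes to everything that
  factors into them.\<close>

definition stabilizer ::
    "(real^'n^'n \<Rightarrow> real^'n^'n \<Rightarrow> real^'n^'n \<Rightarrow> real) \<Rightarrow> (real^'n^'n) set" where
  "stabilizer g = {A. invertible A \<and> invariant {A} g}"

lemma stabilizer_mult:
  assumes "A \<in> stabilizer g" "B \<in> stabilizer g"
  shows "A ** B \<in> stabilizer g"
  using assms
  by (auto simp: stabilizer_def invariant_def congr_mult congr_Sym congr_SymPos invertible_mult)

lemma invariant_imp_stabilizer:
  "invariant G g \<Longrightarrow> A \<in> G \<Longrightarrow> invertible A \<Longrightarrow> A \<in> stabilizer g"
  by (auto simp: stabilizer_def invariant_def)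

lemma subset_stabilizer_imp_invariant: "G \<subseteq> stabilizer g \<Longrightarrow> invariant G g"
  by (auto simp: stabilizer_def invariant_def)

lemma det_pos_invertible: "det (A :: real^'n^'n) > 0 \<Longrightarrow> invertible A"
  by (simp add: invertible_det_nz)

text \<open>Splitting the diagonal into two square roots exhibits the matrix as a point in the orbit
  of the identity.\<close>

lemma diag_mat_SymPos_factor:
  assumes "\<And>i. d i > 0"
  shows "Q ** diag_mat d ** transpose Q = congr (Q ** diag_mat (\<lambda>i. sqrt (d i))) (mat 1)"
proof -
  have "diag_mat d = diag_mat (\<lambda>i. sqrt (d i)) ** diag_mat (\<lambda>i. sqrt (d i))"
    using assms by (simp add: diag_mat_mult less_imp_le)
  then show ?thesis
    by (simp add: congr_def matrix_transpose_mul matrix_mul_assoc)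
qed

text \<open>In a basis diagonalizing \<open>\<Sigma>\<close> and \<open>V\<close> simultaneously, changing the sign of one coordinate
  fixes both.\<close>

lemma exists_det_neg_congr_fixing:
  fixes \<Sigma> V :: "real^'n^'n"
  assumes "\<Sigma> \<in> SymPos" "V \<in> Sym"
  obtains B where "det B < 0" "congr B \<Sigma> = \<Sigma>" "congr B V = V"
proof -
  obtain Q d where Q: "Q \<in> SO" and d: "\<And>i. d i > 0" and \<Sigma>: "\<Sigma> = Q ** diag_mat d ** transpose Q"
    using SymPos_diagonalize[OF assms(1)] by blast
  \<comment> \<open>Pulling back by \<open>L\<close> moves \<Sigma> to the identity, which the
    orthogonal matrix diagonalizing the pulled-back \<open>V\<close> then leaves fixed.\<close>
  define L where "L = Q ** diag_mat (\<lambda>i. sqrt (d i))"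
  have \<Sigma>L: "\<Sigma> = congr L (mat 1)"
    unfolding \<Sigma> L_def using d by (rule diag_mat_SymPos_factor)
  have "det L > 0"
    using Q d by (simp add: L_def det_mul SO_def det_diag_mat prod_pos)
  then obtain L' where L': "L ** L' = mat 1" "L' ** L = mat 1"
    using det_pos_invertible unfolding invertible_def by blast
  obtain R e where R: "R \<in> SO" and VR: "congr L' V = R ** diag_mat e ** transpose R"
    by (rule Sym_diagonalize[OF congr_Sym[OF assms(2)]])
  have RR: "R ** transpose R = mat 1" "transpose R ** R = mat 1"
    using R by (auto simp: SO_def orthogonal_matrix_def)
  \<comment> \<open>Congruence by \<open>M\<close> sends \<open>mat 1\<close> to \<Sigma> and
    \<open>diag_mat e\<close> to \<open>V\<close>; \<open>M'\<close> is its inverse.\<close>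
  define M where "M = L ** R"
  define M' where "M' = transpose R ** L'"
  have "M ** M' = L ** (R ** transpose R) ** L'"
    by (simp only: M_def M'_def matrix_mul_assoc)
  then have MM': "M ** M' = mat 1" by (simp add: RR L')
  then have M'M: "M' ** M = mat 1" by (simp only: matrix_left_right_inverse)
  have \<Sigma>M: "\<Sigma> = congr M (mat 1)"
    using RR by (simp add: M_def congr_mult \<Sigma>L) (simp add: congr_def)
  have "V = congr L (congr L' V)"
    by (simp only: congr_mult[symmetric] L') (simp add: congr_def)
  then have VM: "V = congr M (diag_mat e)"
    by (simp only: VR M_def congr_mult) (simp only: congr_def)
  fix k :: 'n
  define F where "F = flip_mat k"
  have F: "congr F (diag_mat c) = diag_mat c" for c
    by (simp add: congr_def F_def flip_mat_conj_diag_mat)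
  \<comment> \<open>The sign change carried over to the basis formed by the columns of
    \<open>M\<close>.\<close>
  define B where "B = M ** F ** M'"
  have fix_B: "congr B (congr M (diag_mat c)) = congr M (diag_mat c)" for c
  proof -
    have "B ** M = M ** F ** (M' ** M)"
      by (simp only: B_def matrix_mul_assoc)
    then have "B ** M = M ** F" by (simp add: M'M)
    then show ?thesis by (metis F congr_mult)
  qed
  have "det M * det M' = 1"
    by (metis MM' det_I det_mul)
  then have "det B = -1"
    by (simp add: B_def F_def det_mul det_flip_mat)
  moreover have "congr B \<Sigma> = \<Sigma>"
    using fix_B[of "\<lambda>i. 1"] by (simp add: \<Sigma>M diag_mat_1)
  moreover have "congr B V = V"
    using fix_B[of e] by (simp add: VM)
  ultimately show thesis using that[of B] by simp
qed

text \<open>Polarization: expanding both forms on \<open>V + W\<close> isolates the mixed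
  term.\<close>

lemma inner_product_on_Sym_eqI:
  assumes "inner_product_on_Sym b" "inner_product_on_Sym c"
    and quad: "\<And>V. V \<in> Sym \<Longrightarrow> b (congr A V) (congr A V) = c V V"
    and VW: "V \<in> Sym" "W \<in> Sym"
  shows "b (congr A V) (congr A W) = c V W"
proof -
  have expand: "a (X + Y) (X + Y) = a X X + 2 * a X Y + a Y Y"
    if "inner_product_on_Sym a" "X \<in> Sym" "Y \<in> Sym" for a X and Y :: "real^'n^'n"
  proof -
    have "X + Y \<in> Sym"
      using that(2,3) by (simp add: Sym_def transpose_def vec_eq_iff)
    then show ?thesis
      using that unfolding inner_product_on_Sym_def by (smt (verit))
  qed
  have "V + W \<in> Sym"
    using VW by (simp add: Sym_def transpose_def vec_eq_iff)
  have "2 * b (congr A V) (congr A W) = 2 * c V W"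
    using quad[OF \<open>V + W \<in> Sym\<close>] quad[OF VW(1)] quad[OF VW(2)]
      expand[OF assms(1) congr_Sym congr_Sym, OF VW, of A A] expand[OF assms(2) VW]
    by (simp add: congr_add)
  then show ?thesis by simp
qed

text \<open>The matrix \<open>C\<close> that imitates \<open>A\<close> depends on the base point and
  on the tangent vector, so it compares \<open>g\<close> on pairs \<open>(X, X)\<close> only;
  polarization recovers the rest.\<close>

proposition invariant_GL_pos_imp_GL:
  fixes g :: "real^'n^'n \<Rightarrow> real^'n^'n \<Rightarrow> real^'n^'n \<Rightarrow> real"
  assumes g: "riemannian_metric g" and inv: "invariant GL_pos g"
  shows "invariant GL g"
  unfolding invariant_def
proof (intro ballI)
  fix A \<Sigma> V W :: "real^'n^'n"
  assume A: "A \<in> GL" and \<Sigma>: "\<Sigma> \<in> SymPos" and VW: "V \<in> Sym" "W \<in> Sym"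
  have ip: "inner_product_on_Sym (g \<Sigma>)" "inner_product_on_Sym (g (congr A \<Sigma>))"
    using g \<Sigma> A congr_SymPos by (auto simp: riemannian_metric_def GL_def)
  have "g (congr A \<Sigma>) (congr A X) (congr A X) = g \<Sigma> X X" if X: "X \<in> Sym" for X
  proof -
    obtain C where "det C > 0" "congr C \<Sigma> = congr A \<Sigma>" "congr C X = congr A X"
    proof (cases "det A > 0")
      case True
      then show thesis using that by blast
    next
      case False
      then have "det A < 0"
        using A by (simp add: GL_def invertible_det_nz)
      obtain B where B: "det B < 0" "congr B \<Sigma> = \<Sigma>" "congr B X = X"
        by (rule exists_det_neg_congr_fixing[OF \<Sigma> X])
      show thesis
        using that[of "A ** B"] B \<open>det A < 0\<close> by (simp add: det_mul congr_mult mult_neg_neg)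
    qed
    then show ?thesis
      using inv \<Sigma> X unfolding invariant_def GL_pos_def by (metis mem_Collect_eq)
  qed
  then show "g (congr A \<Sigma>) (congr A V) (congr A W) = g \<Sigma> V W"
    using inner_product_on_Sym_eqI[OF ip(2,1) _ VW] by blast
qed

text \<open>With \<open>c\<close> the \<open>n\<close>-th root of the determinant, \<open>A\<close>
  is \<open>c\<close> times a matrix of determinant 1.\<close>

lemma invariant_SL_pos_scalars_imp_GL_pos:
  fixes g :: "real^'n^'n \<Rightarrow> real^'n^'n \<Rightarrow> real^'n^'n \<Rightarrow> real"
  assumes SL: "invariant SL g" and sc: "invariant pos_scalars g"
  shows "invariant GL_pos g"
proof (rule subset_stabilizer_imp_invariant, rule subsetI)
  fix A :: "real^'n^'n"
  assume "A \<in> GL_pos"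
  then have A: "det A > 0" by (simp add: GL_pos_def)
  define c where "c = root CARD('n) (det A)"
  have c: "c > 0" "c ^ CARD('n) = det A"
    using A by (auto simp: c_def)
  define S where "S = diag_mat (\<lambda>i::'n. 1 / c) ** A"
  have "det S = 1"
    using c A by (simp add: S_def det_mul det_diag_mat power_one_over)
  then have "S \<in> stabilizer g"
    by (intro invariant_imp_stabilizer[OF SL]) (auto simp: SL_def det_pos_invertible)
  moreover have "diag_mat (\<lambda>i::'n. c) \<in> stabilizer g"
    using c by (intro invariant_imp_stabilizer[OF sc] det_pos_invertible)
      (auto simp: pos_scalars_def diag_mat_const[symmetric] det_diag_mat A)
  moreover have "A = diag_mat (\<lambda>i. c) ** S"
    using c by (simp add: S_def matrix_mul_assoc diag_mat_mult diag_mat_1)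
  ultimately show "A \<in> stabilizer g"
    using stabilizer_mult by metis
qed

lemma diag_mat_stabilizer:
  assumes "invariant Diag_pos g" "\<And>i. d i > 0"
  shows "diag_mat d \<in> stabilizer g"
proof (rule invariant_imp_stabilizer[OF assms(1)])
  show "diag_mat d \<in> Diag_pos"
    using assms(2) by (simp add: Diag_pos_def diag_mat_def)
  show "invertible (diag_mat d)"
    using assms(2) by (simp add: det_pos_invertible det_diag_mat prod_pos)
qed

text \<open>Polar decomposition: \<open>A A\<^sup>T = Q D\<^sup>2 Q\<^sup>T\<close> gives \<open>A = Q D O\<close> with \<open>O\<close> orthogonal.\<close>

lemma invariant_SO_Diag_pos_imp_GL_pos:
  fixes g :: "real^'n^'n \<Rightarrow> real^'n^'n \<Rightarrow> real^'n^'n \<Rightarrow> real"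
  assumes SO: "invariant SO g" and diag: "invariant Diag_pos g"
  shows "invariant GL_pos g"
proof (rule subset_stabilizer_imp_invariant, rule subsetI)
  fix A :: "real^'n^'n"
  assume "A \<in> GL_pos"
  then have A: "det A > 0" by (simp add: GL_pos_def)
  then obtain Q d where Q: "Q \<in> SO" and d: "\<And>i. d i > 0"
    and AA: "congr A (mat 1) = Q ** diag_mat d ** transpose Q"
    using SymPos_diagonalize[OF congr_SymPos[OF det_pos_invertible mat_1_SymPos]] by blast
  define D where "D = diag_mat (\<lambda>i. sqrt (d i))"
  define D' where "D' = diag_mat (\<lambda>i. 1 / sqrt (d i))"
  have "sqrt (d i) \<noteq> 0" for i using d[of i] by simp
  then have DD': "D ** D' = mat 1" "D' ** D = mat 1"
    by (simp_all add: D_def D'_def diag_mat_mult diag_mat_1[symmetric])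
  have QQ: "Q ** transpose Q = mat 1" "transpose Q ** Q = mat 1"
    using Q by (auto simp: SO_def orthogonal_matrix_def)
  have AQ: "congr A (mat 1) = congr (Q ** D) (mat 1)"
    unfolding AA D_def using d by (rule diag_mat_SymPos_factor)
  \<comment> \<open>The inverse of \<open>Q ** D\<close> times \<open>A\<close>. Both
    \<open>A\<close> and \<open>Q ** D\<close> send \<open>mat 1\<close> to the same point, so
    \<open>R\<close> fixes it, which is orthogonality.\<close>
  define R where "R = D' ** transpose Q ** A"
  have "congr R (mat 1) = congr (D' ** transpose Q) (congr (Q ** D) (mat 1))"
    by (simp only: R_def congr_mult AQ)
  also have "\<dots> = congr (D' ** (transpose Q ** Q) ** D) (mat 1)"
    by (simp only: congr_mult[symmetric] matrix_mul_assoc)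
  also have "\<dots> = mat 1"
    by (simp only: QQ DD' matrix_mul_rid) (simp add: congr_def)
  finally have "orthogonal_matrix R"
    by (simp add: orthogonal_matrix_def congr_def matrix_left_right_inverse)
  moreover have "det R > 0"
    using Q A d by (simp add: R_def D'_def det_mul SO_def det_diag_mat prod_pos det_transpose)
  ultimately have "R \<in> SO"
    using det_orthogonal_matrix by (force simp: SO_def)
  have "invertible B" if "B \<in> SO" for B :: "real^'n^'n"
    using that by (simp add: SO_def det_pos_invertible)
  then have "Q \<in> stabilizer g" "R \<in> stabilizer g"
    using Q \<open>R \<in> SO\<close> invariant_imp_stabilizer[OF SO] by blast+
  moreover have "D \<in> stabilizer g"
    unfolding D_def using d by (intro diag_mat_stabilizer[OF diag]) simp
  moreover have "A = Q ** D ** R"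
  proof -
    have "Q ** D ** R = Q ** (D ** D') ** transpose Q ** A"
      by (simp only: R_def matrix_mul_assoc)
    then show ?thesis by (simp add: DD' QQ)
  qed
  ultimately show "A \<in> stabilizer g"
    using stabilizer_mult by metis
qed

subsection \<open>Permutations and lower triangular matrices\<close>

text \<open>Written entrywise to match the form in which \<open>induct_matrix_elementary\<close>
  presents its shears.\<close>

definition shear_mat :: "'n \<Rightarrow> 'n \<Rightarrow> real \<Rightarrow> real^'n^'n" where
  "shear_mat m n c = (\<chi> i j. if i = m \<and> j = n then c else of_bool (i = j))"

lemma shear_mat_vec:
  assumes "m \<noteq> n"
  shows "(shear_mat m n c *v x) $ i = x $ i + (if i = m then c * x $ n else 0)"
proof -
  have "shear_mat m n c $ i $ j * x $ j
      = (if i = j then x $ j else 0) + (if n = j then (if i = m then c * x $ n else 0) else 0)" for j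
    using assms by (auto simp: shear_mat_def)
  then show ?thesis
    by (simp add: matrix_vector_mult_def sum.distrib)
qed

lemma perm_matrix_vec:
  assumes "p permutes UNIV"
  shows "(perm_matrix p *v x) $ i = x $ inv p i"
proof -
  have "perm_matrix p $ i $ j * x $ j = (if inv p i = j then x $ j else 0)" for j
    using permutes_inverses[OF assms] by (auto simp: perm_matrix_def)
  then show ?thesis
    by (simp add: matrix_vector_mult_def)
qed

lemma perm_matrix_invertible:
  assumes "p permutes UNIV"
  shows "invertible (perm_matrix p)"
proof -
  have "perm_matrix (inv p) ** perm_matrix p = mat 1"
    unfolding matrix_eq matrix_vector_mul_assoc[symmetric]
    using permutes_inverses[OF assms] assms permutes_inv[OF assms]
    by (simp add: vec_eq_iff perm_matrix_vec permutes_inv_inv)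
  then show ?thesis by (auto simp: invertible_left_inverse)
qed

abbreviation swap_mat :: "'n \<Rightarrow> 'n \<Rightarrow> real^'n^'n" where
  "swap_mat m n \<equiv> perm_matrix (Transposition.transpose m n)"

lemma swap_mat_vec: "(swap_mat m n *v x) $ i = x $ Transposition.transpose m n i"
  by (subst perm_matrix_vec) (simp_all add: permutes_swap_id)

text \<open>Conjugation by a transposition exchanges the two coordinates; this is how upper shears
  are obtained from lower ones.\<close>

lemma shear_mat_swap:
  assumes "m \<noteq> n"
  shows "swap_mat m n ** shear_mat n m c ** swap_mat m n = shear_mat m n c"
  unfolding matrix_eq matrix_vector_mul_assoc[symmetric]
  using assms
  by (auto simp: vec_eq_iff swap_mat_vec shear_mat_vec Transposition.transpose_def)

text \<open>Moving the transposition to the right turns the last factor into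
  \<open>shear_mat n m (-1)\<close>. The three shears then multiply to a quarter turn of the
  \<open>m\<close>-\<open>n\<close> plane, which differs from the reflection by the
  transposition.\<close>

lemma flip_mat_product:
  assumes "m \<noteq> n"
  shows "flip_mat n = shear_mat n m (-1) ** shear_mat m n 1 ** swap_mat m n ** shear_mat m n (-1)"
  unfolding matrix_eq matrix_vector_mul_assoc[symmetric]
  using assms
  by (auto simp: vec_eq_iff swap_mat_vec shear_mat_vec diag_mat_vec Transposition.transpose_def)

text \<open>In a nonzero kernel vector take the first nonzero coordinate: the row of that index
  reduces to its diagonal term, which cannot vanish.\<close>

lemma LT_pos_invertible:
  assumes "A \<in> LT_pos"
  shows "invertible A"
proof -
  have "x = 0" if "A *v x = 0" for x
  proof (rule ccontr)
    assume "x \<noteq> 0"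
    define I where "I = {i. x $ i \<noteq> 0}"
    have "finite I" "I \<noteq> {}"
      using \<open>x \<noteq> 0\<close> by (auto simp: I_def vec_eq_iff)
    define i where "i = Min I"
    have "i \<in> I" unfolding i_def using \<open>finite I\<close> \<open>I \<noteq> {}\<close> by (rule Min_in)
    have "A $ i $ j * x $ j = (if i = j then A $ i $ i * x $ i else 0)" for j
    proof (cases i j rule: linorder_cases)
      case less
      then show ?thesis using assms by (simp add: LT_pos_def)
    next
      case equal
      then show ?thesis by simp
    next
      case greater
      then have "j \<notin> I" using \<open>finite I\<close> by (metis Min_le i_def leD)
      then show ?thesis using greater by (simp add: I_def)
    qed
    then have "(\<Sum>j\<in>UNIV. A $ i $ j * x $ j) = (\<Sum>j\<in>UNIV. if i = j then A $ i $ i * x $ i else 0)"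
      by (intro sum.cong refl)
    then have "(A *v x) $ i = A $ i $ i * x $ i"
      by (simp add: matrix_vector_mult_def)
    moreover have "A $ i $ i > 0" using assms by (simp add: LT_pos_def)
    ultimately show False using that \<open>i \<in> I\<close> by (simp add: I_def)
  qed
  then show ?thesis
    by (metis invertible_left_inverse matrix_left_invertible_ker)
qed

text \<open>The stabilizer is closed under products, so it suffices to find in it all shears, all
  transpositions and all invertible diagonal matrices.\<close>

lemma invariant_perm_LT_pos_imp_GL:
  fixes g :: "real^'n::{finite,linorder}^'n::{finite,linorder} \<Rightarrow>
             real^'n::{finite,linorder}^'n::{finite,linorder} \<Rightarrow>
             real^'n::{finite,linorder}^'n::{finite,linorder} \<Rightarrow> real"
  assumes perm: "invariant perm_matrices g" and LT: "invariant LT_pos g"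
  shows "invariant GL g"
proof -
  have LT_stab: "A \<in> stabilizer g" if "A \<in> LT_pos" for A
    using that invariant_imp_stabilizer[OF LT] LT_pos_invertible by blast
  have swap: "swap_mat m n \<in> stabilizer g" for m n
    by (rule invariant_imp_stabilizer[OF perm])
      (auto simp: perm_matrices_def perm_matrix_invertible permutes_swap_id)
  have shear: "shear_mat m n c \<in> stabilizer g" if "m \<noteq> n" for m n c
  proof (cases m n rule: linorder_cases)
    case less
    then have "shear_mat n m c \<in> stabilizer g"
      by (intro LT_stab) (auto simp: LT_pos_def shear_mat_def)
    then show ?thesis
      using shear_mat_swap[OF \<open>m \<noteq> n\<close>] swap stabilizer_mult by metis
  next
    case greater
    then show ?thesis
      by (intro LT_stab) (auto simp: LT_pos_def shear_mat_def)
  qed (use that in simp)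
  have flip: "flip_mat k \<in> stabilizer g" for k
  proof (cases "\<exists>m. m \<noteq> k")
    case True
    then obtain m where "m \<noteq> k" by blast
    then show ?thesis
      using flip_mat_product[OF \<open>m \<noteq> k\<close>] shear swap stabilizer_mult by metis
  next
    \<comment> \<open>Here the dimension is one and the reflection is -I, which acts
      trivially.\<close>
    case False
    then have "flip_mat k = (- 1) *\<^sub>R mat 1"
      by (auto simp: diag_mat_def mat_def vec_eq_iff)
    then have "congr (flip_mat k) X = X" for X
      by (simp only: congr_scalar) simp
    moreover have "invertible (flip_mat k)"
      by (simp add: invertible_det_nz det_flip_mat)
    ultimately show ?thesis
      by (simp add: stabilizer_def invariant_def)
  qed
  \<comment> \<open>The absolute values give a matrix in \<open>LT_pos\<close>; the signs are a
    product of reflections over the set of negative entries.\<close>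
  have diag: "diag_mat d \<in> stabilizer g" if "\<And>i. d i \<noteq> 0" for d
  proof -
    define s where "s = (\<lambda>I (i::'n). if i \<in> I then - 1 else 1 :: real)"
    have signs: "diag_mat (s I) \<in> stabilizer g" if "finite I" for I
      using that
    proof (induction I)
      case empty
      then show ?case
        by (intro LT_stab) (auto simp: LT_pos_def diag_mat_def s_def)
    next
      case (insert k I)
      have "s (insert k I) = (\<lambda>i. (if i = k then - 1 else 1) * s I i)"
        using insert.hyps by (auto simp: s_def)
      then have "diag_mat (s (insert k I)) = flip_mat k ** diag_mat (s I)"
        by (simp only: diag_mat_mult)
      then show ?case using insert.IH flip stabilizer_mult by metis
    qed
    have "diag_mat (\<lambda>i. \<bar>d i\<bar>) \<in> stabilizer g"
      using that by (intro LT_stab) (auto simp: LT_pos_def diag_mat_def)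
    moreover have "diag_mat d = diag_mat (s {i. d i < 0}) ** diag_mat (\<lambda>i. \<bar>d i\<bar>)"
    proof -
      have "d = (\<lambda>i. s {i. d i < 0} i * \<bar>d i\<bar>)" by (auto simp: s_def)
      then show ?thesis by (simp only: diag_mat_mult)
    qed
    ultimately show ?thesis
      using signs[of "{i. d i < 0}"] stabilizer_mult by (metis finite)
  qed
  \<comment> \<open>The induction runs over all matrices, hence the implication: a product is
    invertible only if both factors are, and a matrix with a zero row never is.\<close>
  have "invertible A \<longrightarrow> A \<in> stabilizer g" for A
  proof (induction A rule: induct_matrix_elementary)
    case (1 A B)
    then show ?case
      using stabilizer_mult by (metis det_mul invertible_det_nz mult_zero_left mult_zero_right)
  next
    case (2 A i)
    then show ?case by (simp add: invertible_det_nz det_zero_row)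
  next
    case (3 A)
    have A: "A = diag_mat (\<lambda>i. A $ i $ i)"
      using 3 by (auto simp: diag_mat_def vec_eq_iff)
    show ?case
    proof
      assume "invertible A"
      then have "det A \<noteq> 0" by (simp add: invertible_det_nz)
      then have "A $ i $ i \<noteq> 0" for i
        using det_diagonal[of A] 3 by simp
      then have "diag_mat (\<lambda>i. A $ i $ i) \<in> stabilizer g" by (rule diag)
      then show "A \<in> stabilizer g" by (simp only: A[symmetric])
    qed
  next
    case (4 m n)
    \<comment> \<open>The induction rule presents a transposition as the identity with two columns
      exchanged.\<close>
    have "(\<chi> i j. mat 1 $ i $ Transposition.transpose m n j) = swap_mat m n"
      by (simp add: mat_def perm_matrix_def)
    then show ?case using swap by simp
  next
    case (5 m n c)
    then show ?case using shear by (simp add: shear_mat_def)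
  qed
  then show ?thesis
    by (intro subset_stabilizer_imp_invariant) (auto simp: GL_def)
qed

section \<open>Inclusions in the general linear group, and the equivalences\<close>

lemma Diag_pos_subset_GL: "Diag_pos \<subseteq> GL"
proof
  fix A :: "real^'n^'n"
  assume "A \<in> Diag_pos"
  then have "det A > 0"
    by (subst det_diagonal) (auto simp: Diag_pos_def intro!: prod_pos)
  then show "A \<in> GL" by (simp add: GL_def det_pos_invertible)
qed

lemma pos_scalars_subset_Diag_pos: "pos_scalars \<subseteq> Diag_pos"
  by (auto simp: pos_scalars_def Diag_pos_def mat_def)

lemma perm_matrices_subset_GL: "perm_matrices \<subseteq> GL"
  by (auto simp: GL_def perm_matrices_def perm_matrix_invertible)

lemma subgroups_subset_GL: "GL_pos \<subseteq> GL" "SL \<subseteq> GL" "SO \<subseteq> GL"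
  by (auto simp: GL_def GL_pos_def SL_def SO_def det_pos_invertible)

lemma LT_pos_subset_GL: "LT_pos \<subseteq> GL"
  by (auto simp: GL_def LT_pos_invertible)

theorem theorem3p1:
  fixes g :: "real^'n::{finite,linorder}^'n::{finite,linorder} \<Rightarrow>
             real^'n::{finite,linorder}^'n::{finite,linorder} \<Rightarrow>
             real^'n::{finite,linorder}^'n::{finite,linorder} \<Rightarrow> real"
  assumes "riemannian_metric g"
  shows "(invariant GL g \<longleftrightarrow> invariant GL_pos g) \<and>
         (invariant GL g \<longleftrightarrow> invariant SL g \<and> invariant pos_scalars g) \<and>
         (invariant GL g \<longleftrightarrow> invariant SO g \<and> invariant Diag_pos g) \<and>
         (invariant GL g \<longleftrightarrow> invariant perm_matrices g \<and> invariant LT_pos g)"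
proof -
  have sub: "invariant H g" if "invariant GL g" "H \<subseteq> GL" for H
    using that by (rule invariant_subset)
  note sub = Diag_pos_subset_GL[THEN sub[rotated]] LT_pos_subset_GL[THEN sub[rotated]]
    subset_trans[OF pos_scalars_subset_Diag_pos Diag_pos_subset_GL, THEN sub[rotated]]
    perm_matrices_subset_GL[THEN sub[rotated]] subgroups_subset_GL[THEN sub[rotated]]
  show ?thesis
    \<comment> \<open>Invariance under \<open>GL\<close> restricts to every subset. Conversely, the
      \<open>SL\<close> and \<open>SO\<close> conditions lead back through \<open>GL_pos\<close>,
      while the permutation condition gives \<open>GL\<close> directly.\<close>
    using sub invariant_GL_pos_imp_GL[OF assms]
      invariant_SL_pos_scalars_imp_GL_pos[of g] invariant_SO_Diag_pos_imp_GL_pos[of g]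
      invariant_perm_LT_pos_imp_GL[of g]
    by blast
qed

end
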